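(* In the model-free setting described in the context, with $\mathbf{A}=E(WW^T)$ and $\mu_4=E[(Y-\alpha)^4]$, assume that $\mu_4$ and $\tau^2$ are bounded and that $\frac{\|\mathbf{A}\|_F^2}{n^2}\to0$. Then $$\hat\sigma^2-\sigma^2\overset{p}{\rightarrow}0 .$$
   Context: Setting. $(X_1,Y_1),\dots,(X_n,Y_n)$ are i.i.d. copies of $(X,Y)$ with $X\in\mathbb{R}^p$, $Y\in\mathbb{R}$, $E(Y^2)<\infty$, $E(X)=0$ and $\mathrm{Var}(X)=\mathbf{I}$. No linearity of $E(Y|X)$ is assumed. $(\alpha,\beta)=\arg\min_{a\in\mathbb{R},b\in\mathbb{R}^p}E(Y-a-b^TX)^2$, so $\beta=E(XY)$ and $\alpha=E(Y)$; $\epsilon=Y-\alpha-\beta^TX$. The signal level is $\tau^2=\|\beta\|^2$, the noise level is $\sigma^2=\mathrm{Var}(\epsilon)$, and $\sigma_Y^2=\mathrm{Var}(Y)=\tau^2+\sigma^2$. Limits are as $n\to\infty$ with $p=p_n$. $W=XY$, $W_i=X_iY_i\in\mathbb{R}^p$; $\|\cdot\|_F$ is the Frobenius norm. $\hat\tau^2=\binom n2^{-1}\sum_{i_1<i_2}W_{i_1}^TW_{i_2}$, $\hat\sigma_Y^2=\frac1{n-1}\sum_{i=1}^n(Y_i-\bar Y)^2$, and $\hat\sigma^2=\hat\sigma_Y^2-\hat\tau^2$. *)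

theory Defs
  imports "HOL-Probability.Probability"
begin

text \<open>The dimension \<open>p\<close> varies with the sample size, so a vector of \<open>\<real>\<^sup>p\<close> is a function on the index
  set \<open>{..<p}\<close> (extensional: \<open>undefined\<close> outside it), and the Borel \<open>\<sigma>\<close>-algebra of \<open>\<real>\<^sup>p\<close> is the
  product \<open>\<sigma>\<close>-algebra on that index set.\<close>

abbreviation borel_vec :: "nat \<Rightarrow> (nat \<Rightarrow> real) measure" where
  "borel_vec p \<equiv> Pi\<^sub>M {..<p} (\<lambda>_. borel)"

definition inner_vec :: "nat \<Rightarrow> (nat \<Rightarrow> real) \<Rightarrow> (nat \<Rightarrow> real) \<Rightarrow> real" where
  "inner_vec p u v = (\<Sum>j<p. u j * v j)"

definition frobenius_norm :: "nat \<Rightarrow> (nat \<Rightarrow> nat \<Rightarrow> real) \<Rightarrow> real" where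
  "frobenius_norm p A = sqrt (\<Sum>j<p. \<Sum>k<p. (A j k)\<^sup>2)"

text \<open>\<open>(X, Y)\<close> is the generic pair and \<open>(Xs i, Ys i)\<close>, \<open>1 \<le> i \<le> n\<close>, are its i.i.d. copies. Moments are
  Bochner integrals, which are \<open>0\<close> for non-integrable functions, so integrability is stated
  separately; \<open>integrable_X2\<close> is part of the existence of \<open>Var(X)\<close>.\<close>

locale model_free_sample = prob_space M for M :: "'a measure" +
  fixes n p :: nat
    and X :: "'a \<Rightarrow> nat \<Rightarrow> real" and Y :: "'a \<Rightarrow> real"
    and Xs :: "nat \<Rightarrow> 'a \<Rightarrow> nat \<Rightarrow> real" and Ys :: "nat \<Rightarrow> 'a \<Rightarrow> real"
  assumes measurable_X: "X \<in> M \<rightarrow>\<^sub>M borel_vec p"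
    and measurable_Y: "Y \<in> M \<rightarrow>\<^sub>M borel"
    and indep_sample:
      "indep_vars (\<lambda>_. borel_vec p \<Otimes>\<^sub>M borel) (\<lambda>i \<omega>. (Xs i \<omega>, Ys i \<omega>)) {1..n}"
    and identically_distributed: "\<And>i. i \<in> {1..n} \<Longrightarrow>
      distr M (borel_vec p \<Otimes>\<^sub>M borel) (\<lambda>\<omega>. (Xs i \<omega>, Ys i \<omega>)) =
      distr M (borel_vec p \<Otimes>\<^sub>M borel) (\<lambda>\<omega>. (X \<omega>, Y \<omega>))"
    and integrable_Y2: "integrable M (\<lambda>\<omega>. (Y \<omega>)\<^sup>2)"
    and integrable_X2: "\<And>j. j < p \<Longrightarrow> integrable M (\<lambda>\<omega>. (X \<omega> j)\<^sup>2)"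
    and mean_X: "\<And>j. j < p \<Longrightarrow> expectation (\<lambda>\<omega>. X \<omega> j) = 0"
    and covariance_X: "\<And>j k. j < p \<Longrightarrow> k < p \<Longrightarrow>
      expectation (\<lambda>\<omega>. (X \<omega> j - expectation (\<lambda>\<omega>. X \<omega> j)) * (X \<omega> k - expectation (\<lambda>\<omega>. X \<omega> k)))
      = (if j = k then 1 else 0)"

text \<open>Population quantities. The vector \<open>b\<close> ranges over the extensional functions on \<open>{..<p}\<close>, so that
  the minimiser of the quadratic loss is unique as an element of the type.\<close>

definition best_linear :: "'a measure \<Rightarrow> nat \<Rightarrow> ('a \<Rightarrow> nat \<Rightarrow> real) \<Rightarrow> ('a \<Rightarrow> real) \<Rightarrow> real \<times> (nat \<Rightarrow> real)"
  where "best_linear M p X Y =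
    arg_min_on (\<lambda>(a, b). \<integral>\<omega>. (Y \<omega> - a - inner_vec p b (X \<omega>))\<^sup>2 \<partial>M) (UNIV \<times> ({..<p} \<rightarrow>\<^sub>E UNIV))"

definition alpha :: "'a measure \<Rightarrow> nat \<Rightarrow> ('a \<Rightarrow> nat \<Rightarrow> real) \<Rightarrow> ('a \<Rightarrow> real) \<Rightarrow> real" where
  "alpha M p X Y = fst (best_linear M p X Y)"

definition beta :: "'a measure \<Rightarrow> nat \<Rightarrow> ('a \<Rightarrow> nat \<Rightarrow> real) \<Rightarrow> ('a \<Rightarrow> real) \<Rightarrow> nat \<Rightarrow> real" where
  "beta M p X Y = snd (best_linear M p X Y)"

definition residual :: "'a measure \<Rightarrow> nat \<Rightarrow> ('a \<Rightarrow> nat \<Rightarrow> real) \<Rightarrow> ('a \<Rightarrow> real) \<Rightarrow> 'a \<Rightarrow> real" where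
  "residual M p X Y \<omega> = Y \<omega> - alpha M p X Y - inner_vec p (beta M p X Y) (X \<omega>)"

definition tau2 :: "'a measure \<Rightarrow> nat \<Rightarrow> ('a \<Rightarrow> nat \<Rightarrow> real) \<Rightarrow> ('a \<Rightarrow> real) \<Rightarrow> real" where
  "tau2 M p X Y = inner_vec p (beta M p X Y) (beta M p X Y)"

definition sigma2 :: "'a measure \<Rightarrow> nat \<Rightarrow> ('a \<Rightarrow> nat \<Rightarrow> real) \<Rightarrow> ('a \<Rightarrow> real) \<Rightarrow> real" where
  "sigma2 M p X Y = prob_space.variance M (residual M p X Y)"

definition mu4 :: "'a measure \<Rightarrow> nat \<Rightarrow> ('a \<Rightarrow> nat \<Rightarrow> real) \<Rightarrow> ('a \<Rightarrow> real) \<Rightarrow> real" where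
  "mu4 M p X Y = (\<integral>\<omega>. (Y \<omega> - alpha M p X Y) ^ 4 \<partial>M)"

definition Wvec :: "(nat \<Rightarrow> real) \<Rightarrow> real \<Rightarrow> nat \<Rightarrow> real" where
  "Wvec x y j = x j * y"

definition A_mat :: "'a measure \<Rightarrow> ('a \<Rightarrow> nat \<Rightarrow> real) \<Rightarrow> ('a \<Rightarrow> real) \<Rightarrow> nat \<Rightarrow> nat \<Rightarrow> real" where
  "A_mat M X Y j k = (\<integral>\<omega>. Wvec (X \<omega>) (Y \<omega>) j * Wvec (X \<omega>) (Y \<omega>) k \<partial>M)"

text \<open>Estimators, as functions of the data \<open>(x 1, y 1), \<dots>, (x n, y n)\<close>.\<close>

definition tau2_hat :: "nat \<Rightarrow> nat \<Rightarrow> (nat \<Rightarrow> nat \<Rightarrow> real) \<Rightarrow> (nat \<Rightarrow> real) \<Rightarrow> real" where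
  "tau2_hat n p x y = inverse (real (n choose 2)) *
    (\<Sum>(i, k)\<in>{(i, k). 1 \<le> i \<and> i < k \<and> k \<le> n}. inner_vec p (Wvec (x i) (y i)) (Wvec (x k) (y k)))"

definition sample_mean :: "nat \<Rightarrow> (nat \<Rightarrow> real) \<Rightarrow> real" where
  "sample_mean n y = (\<Sum>i=1..n. y i) / real n"

definition sigma2_Y_hat :: "nat \<Rightarrow> (nat \<Rightarrow> real) \<Rightarrow> real" where
  "sigma2_Y_hat n y = 1 / (real n - 1) * (\<Sum>i=1..n. (y i - sample_mean n y)\<^sup>2)"

definition sigma2_hat :: "nat \<Rightarrow> nat \<Rightarrow> (nat \<Rightarrow> nat \<Rightarrow> real) \<Rightarrow> (nat \<Rightarrow> real) \<Rightarrow> real" where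
  "sigma2_hat n p x y = sigma2_Y_hat n y - tau2_hat n p x y"

text \<open>Convergence in probability to a constant; the \<open>n\<close>-th variable may live on its own probability
  space, as for triangular arrays.\<close>

definition tendsto_in_prob :: "(nat \<Rightarrow> 'a measure) \<Rightarrow> (nat \<Rightarrow> 'a \<Rightarrow> real) \<Rightarrow> real \<Rightarrow> bool" where
  "tendsto_in_prob M Z c \<longleftrightarrow>
    (\<forall>e>0. (\<lambda>n. measure (M n) {\<omega> \<in> space (M n). \<bar>Z n \<omega> - c\<bar> > e}) \<longlonglongrightarrow> 0)"

end

theory Submission
  imports Defs
begin

text \<open>Why the estimator is consistent. The error is shown to vanish in mean square, which suffices by
  Chebyshev's inequality. Write \<open>Z = Y - \<alpha>\<close> and \<open>V = W - \<beta>\<close>. The minimisation that defines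
  \<open>(\<alpha>, \<beta>)\<close> has the unique solution \<open>\<alpha> = E Y\<close>, \<open>\<beta> = E W\<close> (\<open>best_linear_eq\<close>), so \<open>Z\<close> and \<open>V\<close> are
  centered, and \<open>\<sigma>\<^sup>2 = Var(Y) - \<tau>\<^sup>2\<close> (\<open>sigma2_eq\<close>).

  Both parts of the estimator are averages over pairs of observations. Separating in each the terms
  that depend on a single observation from the degenerate remainder gives (\<open>estimation_error\<close>)
  the error as the average of the influence function \<open>Z\<^sub>i\<^sup>2 - Var(Y) - 2 \<beta>\<^sup>T V\<^sub>i\<close>, minus the averages of
  \<open>Z\<^sub>i Z\<^sub>k\<close> and of \<open>V\<^sub>i\<^sup>T V\<^sub>k\<close> over the pairs \<open>i < k\<close>.

  The first average has variance at most \<open>(2 \<mu>\<^sub>4 + 8 \<beta>\<^sup>T A \<beta>) / n\<close>, where \<open>\<beta>\<^sup>T A \<beta> \<le> \<tau>\<^sup>2 \<parallel>A\<parallel>\<^sub>F\<close> by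
  Cauchy-Schwarz. The pair averages are degenerate: distinct pairs are uncorrelated, so a sum over
  pairs of a centered vector with covariance \<open>C\<close> has second moment \<open>\<parallel>C\<parallel>\<^sub>F\<^sup>2\<close> times the number of pairs
  (\<open>second_moment_pair_sum\<close>). For \<open>V\<close> this is controlled by \<open>\<parallel>A\<parallel>\<^sub>F\<^sup>2\<close> (\<open>frobenius_covariance_le\<close>), and for
  \<open>Z\<close> by \<open>Var(Y)\<^sup>2 \<le> \<mu>\<^sub>4\<close>. Since \<open>\<mu>\<^sub>4\<close> and \<open>\<tau>\<^sup>2\<close> are bounded and \<open>\<parallel>A\<parallel>\<^sub>F / n \<longlonglongrightarrow> 0\<close>, all three
  contributions vanish.\<close>

section \<open>Sums and pair sums of independent centered vectors\<close>

lemma integrable_mult_of_squares: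
  fixes f g :: "'a \<Rightarrow> real"
  assumes [measurable]: "f \<in> borel_measurable M" "g \<in> borel_measurable M"
    and "integrable M (\<lambda>x. (f x)\<^sup>2)" "integrable M (\<lambda>x. (g x)\<^sup>2)"
  shows "integrable M (\<lambda>x. f x * g x)"
proof (rule Bochner_Integration.integrable_bound)
  show "integrable M (\<lambda>x. (f x)\<^sup>2 + (g x)\<^sup>2)"
    using assms by simp
  have "\<bar>f x * g x\<bar> \<le> (f x)\<^sup>2 + (g x)\<^sup>2" for x
  proof -
    have "0 \<le> (\<bar>f x\<bar> - \<bar>g x\<bar>)\<^sup>2" "0 \<le> (f x)\<^sup>2" "0 \<le> (g x)\<^sup>2" by simp_all
    then show ?thesis
      unfolding power2_diff power2_abs abs_mult by linarith
  qed
  then show "AE x in M. norm (f x * g x) \<le> norm ((f x)\<^sup>2 + (g x)\<^sup>2)"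
    by simp
qed measurable

lemma integrable_power2_sum:
  fixes f :: "'b \<Rightarrow> 'a \<Rightarrow> real"
  assumes "finite I" "\<And>i. i \<in> I \<Longrightarrow> f i \<in> borel_measurable M"
    and "\<And>i. i \<in> I \<Longrightarrow> integrable M (\<lambda>x. (f i x)\<^sup>2)"
  shows "integrable M (\<lambda>x. (\<Sum>i\<in>I. f i x)\<^sup>2)"
  unfolding power2_eq_square sum_product
  by (intro Bochner_Integration.integrable_sum integrable_mult_of_squares assms)

lemma sum_inner_vec_left: "(\<Sum>i\<in>I. inner_vec p (u i) v) = inner_vec p (\<lambda>j. \<Sum>i\<in>I. u i j) v"
  unfolding inner_vec_def by (subst sum.swap) (simp add: sum_distrib_right)

lemma inner_vec_power2:
  "(inner_vec p u v)\<^sup>2 = (\<Sum>j<p. \<Sum>l<p. (u j * u l) * (v j * v l))"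
  unfolding inner_vec_def power2_eq_square sum_product by (simp add: ac_simps)

text \<open>The two ingredients of a second moment calculation for a \<open>U\<close>-statistic with kernel
  \<open>\<langle>u, v\<rangle>\<close>: independence and a common covariance matrix \<open>C\<close>. The same locale serves the vectors \<open>W\<^sub>i - \<beta>\<close> and, with \<open>p = 1\<close>,
  real random variables.\<close>

locale independent_centered_vectors = prob_space M for M :: "'a measure" +
  fixes n p :: nat and V :: "nat \<Rightarrow> 'a \<Rightarrow> nat \<Rightarrow> real" and C :: "nat \<Rightarrow> nat \<Rightarrow> real"
  assumes indep: "indep_vars (\<lambda>_. borel_vec p) V {1..n}"
    and square_integrable: "\<And>i j. i \<in> {1..n} \<Longrightarrow> j < p \<Longrightarrow> integrable M (\<lambda>\<omega>. (V i \<omega> j)\<^sup>2)"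
    and centered: "\<And>i j. i \<in> {1..n} \<Longrightarrow> j < p \<Longrightarrow> expectation (\<lambda>\<omega>. V i \<omega> j) = 0"
    and covariance: "\<And>i j l. i \<in> {1..n} \<Longrightarrow> j < p \<Longrightarrow> l < p \<Longrightarrow>
      expectation (\<lambda>\<omega>. V i \<omega> j * V i \<omega> l) = C j l"
begin

definition partial_sum :: "nat \<Rightarrow> 'a \<Rightarrow> nat \<Rightarrow> real" where
  "partial_sum m \<omega> j = (\<Sum>i=1..m. V i \<omega> j)"

definition pair_sum :: "nat \<Rightarrow> 'a \<Rightarrow> real" where
  "pair_sum m \<omega> = (\<Sum>k=1..m. \<Sum>i=1..<k. inner_vec p (V i \<omega>) (V k \<omega>))"

text \<open>Adding one observation changes the pair sum by an inner product of a function of the past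
  with the new vector. Since the latter is independent of the past and centered, the pair sum is a
  martingale, and the second moments below can be computed by induction on the number of observations
  instead of by a case distinction on coincidences among four indices.\<close>

lemma pair_sum_Suc:
  "pair_sum (Suc m) \<omega> = pair_sum m \<omega> + inner_vec p (partial_sum m \<omega>) (V (Suc m) \<omega>)"
  by (simp add: pair_sum_def partial_sum_def[abs_def] sum_inner_vec_left atLeastLessThanSuc_atLeastAtMost)

lemma measurable_V: "i \<in> {1..n} \<Longrightarrow> V i \<in> M \<rightarrow>\<^sub>M borel_vec p"
  using indep by (auto simp: indep_vars_def)

lemma measurable_coordinate: "i \<in> {1..n} \<Longrightarrow> j < p \<Longrightarrow> (\<lambda>\<omega>. V i \<omega> j) \<in> borel_measurable M"
  by (rule measurable_compose[OF measurable_V, where g = "\<lambda>v. v j"]) auto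

lemma measurable_partial_sum: "m \<le> n \<Longrightarrow> j < p \<Longrightarrow> (\<lambda>\<omega>. partial_sum m \<omega> j) \<in> borel_measurable M"
  unfolding partial_sum_def by (intro borel_measurable_sum measurable_coordinate) auto

lemma measurable_pair_sum: "m \<le> n \<Longrightarrow> pair_sum m \<in> borel_measurable M"
  unfolding pair_sum_def[abs_def] inner_vec_def
  by (intro borel_measurable_sum borel_measurable_times measurable_coordinate) auto

text \<open>The factorisation behind both inductions: the past enters only through the restriction of
  \<open>V\<close> to \<open>{1..m}\<close>, hence any integrable function \<open>F\<close> of it is uncorrelated with a function of
  \<open>V (Suc m)\<close>.\<close>

lemma past_times_next:
  fixes F :: "'a \<Rightarrow> real" and g :: "(nat \<Rightarrow> real) \<Rightarrow> real"
  assumes m: "Suc m \<le> n"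
    and f: "f \<in> borel_measurable (Pi\<^sub>M {1..m} (\<lambda>_. borel_vec p))"
    and g: "g \<in> borel_measurable (borel_vec p)"
    and eq: "\<And>\<omega>. F \<omega> = f (restrict (\<lambda>i. V i \<omega>) {1..m})"
    and int: "integrable M F" "integrable M (\<lambda>\<omega>. g (V (Suc m) \<omega>))"
  shows "integrable M (\<lambda>\<omega>. F \<omega> * g (V (Suc m) \<omega>))" (is ?I)
    and "expectation (\<lambda>\<omega>. F \<omega> * g (V (Suc m) \<omega>)) =
      expectation F * expectation (\<lambda>\<omega>. g (V (Suc m) \<omega>))" (is ?E)
proof -
  have "indep_var borel (f \<circ> (\<lambda>\<omega>. restrict (\<lambda>i. V i \<omega>) {1..m}))
      borel ((\<lambda>x. g (x (Suc m))) \<circ> (\<lambda>\<omega>. restrict (\<lambda>i. V i \<omega>) {Suc m}))"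
    using m g by (intro indep_var_compose[OF indep_var_restrict[OF indep] f]) auto
  then have ind: "indep_var borel F borel (\<lambda>\<omega>. g (V (Suc m) \<omega>))"
    by (simp add: comp_def eq[abs_def])
  show ?I ?E
    using indep_var_integrable[OF ind int] indep_var_lebesgue_integral[OF ind int] by auto
qed

lemma integrable_V: "i \<in> {1..n} \<Longrightarrow> j < p \<Longrightarrow> integrable M (\<lambda>\<omega>. V i \<omega> j)"
  using measurable_coordinate square_integrable by (rule square_integrable_imp_integrable)

lemma integrable_VV:
  "i \<in> {1..n} \<Longrightarrow> j < p \<Longrightarrow> l < p \<Longrightarrow> integrable M (\<lambda>\<omega>. V i \<omega> j * V i \<omega> l)"
  by (intro integrable_mult_of_squares measurable_coordinate square_integrable)

lemma integrable_partial_sum_power2: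
  "m \<le> n \<Longrightarrow> j < p \<Longrightarrow> integrable M (\<lambda>\<omega>. (partial_sum m \<omega> j)\<^sup>2)"
  unfolding partial_sum_def
  by (intro integrable_power2_sum measurable_coordinate square_integrable) auto

lemma integrable_partial_sum_mult:
  "m \<le> n \<Longrightarrow> j < p \<Longrightarrow> l < p \<Longrightarrow> integrable M (\<lambda>\<omega>. partial_sum m \<omega> j * partial_sum m \<omega> l)"
  by (intro integrable_mult_of_squares measurable_partial_sum integrable_partial_sum_power2)

lemma integrable_partial_sum: "m \<le> n \<Longrightarrow> j < p \<Longrightarrow> integrable M (\<lambda>\<omega>. partial_sum m \<omega> j)"
  using measurable_partial_sum integrable_partial_sum_power2 by (rule square_integrable_imp_integrable)

lemma coordinate_of_past:
  "i \<in> {1..m} \<Longrightarrow> j < p \<Longrightarrow> (\<lambda>x. x i j) \<in> borel_measurable (Pi\<^sub>M {1..m} (\<lambda>_. borel_vec p))"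
  by (rule measurable_compose[where f = "\<lambda>x. x i" and g = "\<lambda>v. v j" and N = "borel_vec p"]) auto

lemma partial_sum_of_past:
  "j < p \<Longrightarrow> (\<lambda>x. \<Sum>i=1..m. x i j) \<in> borel_measurable (Pi\<^sub>M {1..m} (\<lambda>_. borel_vec p))"
  by (intro borel_measurable_sum coordinate_of_past)

lemma second_moment_partial_sum:
  assumes "m \<le> n" "j < p" "l < p"
  shows "expectation (\<lambda>\<omega>. partial_sum m \<omega> j * partial_sum m \<omega> l) = real m * C j l"
  using assms(1)
proof (induction m)
  case 0
  then show ?case by (simp add: partial_sum_def)
next
  case (Suc m)
  let ?S = "partial_sum m" and ?V = "V (Suc m)"
  have mn: "m \<le> n" using Suc.prems by simp
  have cross: "integrable M (\<lambda>\<omega>. ?S \<omega> a * ?V \<omega> b)" "expectation (\<lambda>\<omega>. ?S \<omega> a * ?V \<omega> b) = 0"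
    if "a < p" "b < p" for a b
  proof -
    have eq: "?S \<omega> a = (\<Sum>i=1..m. (restrict (\<lambda>i. V i \<omega>) {1..m}) i a)" for \<omega>
      by (simp add: partial_sum_def)
    have g: "(\<lambda>v. v b) \<in> borel_measurable (borel_vec p)"
      using that by simp
    have intV: "integrable M (\<lambda>\<omega>. ?V \<omega> b)"
      using that Suc.prems by (intro integrable_V) auto
    show "integrable M (\<lambda>\<omega>. ?S \<omega> a * ?V \<omega> b)" "expectation (\<lambda>\<omega>. ?S \<omega> a * ?V \<omega> b) = 0"
      using past_times_next[OF Suc.prems partial_sum_of_past[OF that(1)] g eq integrable_partial_sum[OF mn that(1)] intV]
        that Suc.prems by (simp_all add: centered)
  qed
  have "expectation (\<lambda>\<omega>. partial_sum (Suc m) \<omega> j * partial_sum (Suc m) \<omega> l) =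
    expectation (\<lambda>\<omega>. ?S \<omega> j * ?S \<omega> l + ?S \<omega> j * ?V \<omega> l + ?S \<omega> l * ?V \<omega> j + ?V \<omega> j * ?V \<omega> l)"
    by (simp add: partial_sum_def algebra_simps)
  also have "\<dots> = real m * C j l + C j l"
    using Suc assms cross by (simp add: integrable_partial_sum_mult integrable_VV covariance)
  finally show ?case by (simp add: algebra_simps)
qed

text \<open>By orthogonality of martingale increments, the second moment grows in step \<open>m + 1\<close> by
  \<open>E \<langle>S\<^sub>m, V\<^sub>m\<^sub>+\<^sub>1\<rangle>\<^sup>2 = \<Sum>\<^sub>j\<^sub>l E (S\<^sub>m\<^sub>j S\<^sub>m\<^sub>l) E (V\<^sub>j V\<^sub>l) = m \<parallel>C\<parallel>\<^sub>F\<^sup>2\<close>, and these increments add up to a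
  binomial coefficient. Integrability is part of the induction because the cross term
  \<open>T\<^sub>m S\<^sub>m\<^sub>j\<close> is integrable only through the square integrability of \<open>T\<^sub>m\<close>.\<close>

lemma second_moment_pair_sum:
  assumes "m \<le> n"
  shows "integrable M (\<lambda>\<omega>. (pair_sum m \<omega>)\<^sup>2) \<and>
    expectation (\<lambda>\<omega>. (pair_sum m \<omega>)\<^sup>2) = real (m choose 2) * (\<Sum>j<p. \<Sum>l<p. (C j l)\<^sup>2)"
  using assms
proof (induction m)
  case 0
  then show ?case by (simp add: pair_sum_def)
next
  case (Suc m)
  let ?S = "partial_sum m" and ?V = "V (Suc m)" and ?T = "pair_sum m"
  have IH: "integrable M (\<lambda>\<omega>. (?T \<omega>)\<^sup>2)"
    "expectation (\<lambda>\<omega>. (?T \<omega>)\<^sup>2) = real (m choose 2) * (\<Sum>j<p. \<Sum>l<p. (C j l)\<^sup>2)"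
    using Suc by auto
  have mn: "m \<le> n" using Suc.prems by simp
  have TS: "integrable M (\<lambda>\<omega>. ?T \<omega> * ?S \<omega> j * ?V \<omega> j)" "expectation (\<lambda>\<omega>. ?T \<omega> * ?S \<omega> j * ?V \<omega> j) = 0"
    if "j < p" for j
  proof -
    let ?f = "\<lambda>x. (\<Sum>k=1..m. \<Sum>i=1..<k. inner_vec p (x i) (x k)) * (\<Sum>i=1..m. x i j)"
    have f: "?f \<in> borel_measurable (Pi\<^sub>M {1..m} (\<lambda>_. borel_vec p))"
      unfolding inner_vec_def using that
      by (intro borel_measurable_sum borel_measurable_times coordinate_of_past) auto
    have eq: "?T \<omega> * ?S \<omega> j = ?f (restrict (\<lambda>i. V i \<omega>) {1..m})" for \<omega>
      by (simp add: pair_sum_def partial_sum_def)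
    have int: "integrable M (\<lambda>\<omega>. ?T \<omega> * ?S \<omega> j)"
      using that mn IH
      by (intro integrable_mult_of_squares measurable_pair_sum measurable_partial_sum integrable_partial_sum_power2)
    have g: "(\<lambda>v. v j) \<in> borel_measurable (borel_vec p)"
      using that by simp
    have intV: "integrable M (\<lambda>\<omega>. ?V \<omega> j)"
      using that Suc.prems by (intro integrable_V) auto
    show "integrable M (\<lambda>\<omega>. ?T \<omega> * ?S \<omega> j * ?V \<omega> j)" "expectation (\<lambda>\<omega>. ?T \<omega> * ?S \<omega> j * ?V \<omega> j) = 0"
      using past_times_next[OF Suc.prems f g eq int intV] that Suc.prems by (simp_all add: centered)
  qed
  have SS: "integrable M (\<lambda>\<omega>. (?S \<omega> j * ?S \<omega> l) * (?V \<omega> j * ?V \<omega> l))"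
      "expectation (\<lambda>\<omega>. (?S \<omega> j * ?S \<omega> l) * (?V \<omega> j * ?V \<omega> l)) = real m * (C j l)\<^sup>2"
    if "j < p" "l < p" for j l
  proof -
    let ?f = "\<lambda>x. (\<Sum>i=1..m. x i j) * (\<Sum>i=1..m. x i l)"
    have f: "?f \<in> borel_measurable (Pi\<^sub>M {1..m} (\<lambda>_. borel_vec p))"
      using that by (intro borel_measurable_times partial_sum_of_past)
    have eq: "?S \<omega> j * ?S \<omega> l = ?f (restrict (\<lambda>i. V i \<omega>) {1..m})" for \<omega>
      by (simp add: partial_sum_def)
    have g: "(\<lambda>v. v j * v l) \<in> borel_measurable (borel_vec p)"
      using that by simp
    have intV: "integrable M (\<lambda>\<omega>. ?V \<omega> j * ?V \<omega> l)"
      using that Suc.prems by (intro integrable_VV) auto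
    show "integrable M (\<lambda>\<omega>. (?S \<omega> j * ?S \<omega> l) * (?V \<omega> j * ?V \<omega> l))"
      "expectation (\<lambda>\<omega>. (?S \<omega> j * ?S \<omega> l) * (?V \<omega> j * ?V \<omega> l)) = real m * (C j l)\<^sup>2"
      using past_times_next[OF Suc.prems f g eq integrable_partial_sum_mult[OF mn that] intV] that Suc.prems mn
      by (simp_all add: covariance second_moment_partial_sum power2_eq_square)
  qed
  define A where "A \<omega> = (\<Sum>j<p. ?T \<omega> * ?S \<omega> j * ?V \<omega> j)" for \<omega>
  define B where "B \<omega> = (\<Sum>j<p. \<Sum>l<p. (?S \<omega> j * ?S \<omega> l) * (?V \<omega> j * ?V \<omega> l))" for \<omega>
  have A: "integrable M A" "expectation A = 0"
    unfolding A_def[abs_def] using TS by (auto simp: Bochner_Integration.integral_sum)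
  have B: "integrable M B \<and> expectation B = (\<Sum>j<p. \<Sum>l<p. real m * (C j l)\<^sup>2)"
    unfolding B_def[abs_def] has_bochner_integral_iff[symmetric]
    by (intro has_bochner_integral_sum)
      (use SS in \<open>auto simp only: has_bochner_integral_iff lessThan_iff\<close>)
  have expand: "(\<lambda>\<omega>. (pair_sum (Suc m) \<omega>)\<^sup>2) = (\<lambda>\<omega>. (?T \<omega>)\<^sup>2 + 2 * A \<omega> + B \<omega>)"
    unfolding pair_sum_Suc power2_sum inner_vec_power2 A_def B_def
    by (simp add: inner_vec_def sum_distrib_left ac_simps)
  have "real (m choose 2) * (\<Sum>j<p. \<Sum>l<p. (C j l)\<^sup>2) + (\<Sum>j<p. \<Sum>l<p. real m * (C j l)\<^sup>2)
      = real (Suc m choose 2) * (\<Sum>j<p. \<Sum>l<p. (C j l)\<^sup>2)"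
    by (simp add: numeral_2_eq_2 sum_distrib_left[symmetric] algebra_simps)
  then show ?case
    unfolding expand using A B IH by simp
qed

end

text \<open>The case of dimension one, in which a random variable is read as a vector with the single
  index \<open>0\<close>.\<close>

lemma (in prob_space) scalar_second_moments:
  fixes U :: "nat \<Rightarrow> 'a \<Rightarrow> real"
  assumes indep: "indep_vars (\<lambda>_. borel) U {1..n}"
    and sq: "\<And>i. i \<in> {1..n} \<Longrightarrow> integrable M (\<lambda>\<omega>. (U i \<omega>)\<^sup>2)"
    and mean: "\<And>i. i \<in> {1..n} \<Longrightarrow> expectation (U i) = 0"
    and var: "\<And>i. i \<in> {1..n} \<Longrightarrow> expectation (\<lambda>\<omega>. (U i \<omega>)\<^sup>2) = c"
  shows "integrable M (\<lambda>\<omega>. (\<Sum>i=1..n. U i \<omega>)\<^sup>2)"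
    and "expectation (\<lambda>\<omega>. (\<Sum>i=1..n. U i \<omega>)\<^sup>2) = real n * c"
    and "integrable M (\<lambda>\<omega>. (\<Sum>k=1..n. \<Sum>i=1..<k. U i \<omega> * U k \<omega>)\<^sup>2)"
    and "expectation (\<lambda>\<omega>. (\<Sum>k=1..n. \<Sum>i=1..<k. U i \<omega> * U k \<omega>)\<^sup>2) = real (n choose 2) * c\<^sup>2"
proof -
  interpret U: independent_centered_vectors M n "Suc 0" "\<lambda>i \<omega>. \<lambda>j\<in>{..<Suc 0}. U i \<omega>" "\<lambda>_ _. c"
  proof
    show "indep_vars (\<lambda>_. borel_vec (Suc 0)) (\<lambda>i \<omega>. \<lambda>j\<in>{..<Suc 0}. U i \<omega>) {1..n}"
      by (rule indep_vars_compose2[OF indep, where Y = "\<lambda>_ u. \<lambda>j\<in>{..<Suc 0}. u"])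
        (intro measurable_restrict measurable_ident_sets refl)
  qed (use sq mean var in \<open>simp_all add: power2_eq_square\<close>)
  show "integrable M (\<lambda>\<omega>. (\<Sum>i=1..n. U i \<omega>)\<^sup>2)"
    using U.integrable_partial_sum_power2[of n 0] by (simp add: U.partial_sum_def)
  show "expectation (\<lambda>\<omega>. (\<Sum>i=1..n. U i \<omega>)\<^sup>2) = real n * c"
    using U.second_moment_partial_sum[of n 0 0] by (simp add: U.partial_sum_def power2_eq_square)
  show "integrable M (\<lambda>\<omega>. (\<Sum>k=1..n. \<Sum>i=1..<k. U i \<omega> * U k \<omega>)\<^sup>2)"
    "expectation (\<lambda>\<omega>. (\<Sum>k=1..n. \<Sum>i=1..<k. U i \<omega> * U k \<omega>)\<^sup>2) = real (n choose 2) * c\<^sup>2"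
    using U.second_moment_pair_sum[of n] by (simp_all add: U.pair_sum_def inner_vec_def)
qed

section \<open>The estimators as averages over observations and over pairs\<close>

text \<open>Each index belongs to \<open>n - 1\<close> pairs; the factor is a real number so that \<open>n = 0\<close> is no
  exception.\<close>

lemma sum_pairs_add:
  fixes a :: "nat \<Rightarrow> real"
  shows "(\<Sum>k=1..n. \<Sum>i=1..<k. a i + a k) = (real n - 1) * (\<Sum>i=1..n. a i)"
proof (induction n)
  case (Suc n)
  have "(\<Sum>i=1..<Suc n. a i + a (Suc n)) = (\<Sum>i=1..n. a i) + real n * a (Suc n)"
    by (simp add: sum.distrib atLeastLessThanSuc_atLeastAtMost)
  with Suc show ?case by (simp add: algebra_simps)
qed simp

lemma real_choose_two: "real (n choose 2) = real n * (real n - 1) / 2"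
  by (induction n) (simp_all add: numeral_2_eq_2 algebra_simps)

lemma sum_pairs_const: "(\<Sum>k=1..n. \<Sum>i=1..<k. c) = real (n choose 2) * c" for c :: real
  using sum_pairs_add[where a = "\<lambda>_. c / 2" and n = n] by (simp add: real_choose_two algebra_simps)

lemma sum_over_pairs:
  "(\<Sum>(i, k)\<in>{(i, k). 1 \<le> i \<and> i < k \<and> k \<le> n}. g i k) = (\<Sum>k=1..n. \<Sum>i=1..<k. g i k)"
  for g :: "nat \<Rightarrow> nat \<Rightarrow> real"
proof -
  have "(\<Sum>k=1..n. \<Sum>i=1..<k. g i k) = (\<Sum>(k, i)\<in>(SIGMA k:{1..n}. {1..<k}). g i k)"
    by (subst sum.Sigma) auto
  also have "\<dots> = (\<Sum>(i, k)\<in>{(i, k). 1 \<le> i \<and> i < k \<and> k \<le> n}. g i k)"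
    by (rule sum.reindex_bij_witness[where i = prod.swap and j = prod.swap]) auto
  finally show ?thesis by simp
qed

lemma power2_sum_eq_pairs:
  fixes z :: "nat \<Rightarrow> real"
  shows "(\<Sum>i=1..n. z i)\<^sup>2 = (\<Sum>i=1..n. (z i)\<^sup>2) + 2 * (\<Sum>k=1..n. \<Sum>i=1..<k. z i * z k)"
proof (induction n)
  case (Suc n)
  have "(\<Sum>i=1..<Suc n. z i * z (Suc n)) = (\<Sum>i=1..n. z i) * z (Suc n)"
    by (simp add: sum_distrib_right atLeastLessThanSuc_atLeastAtMost)
  with Suc show ?case by (simp add: power2_sum)
qed simp

text \<open>The sample variance is invariant under the shift by \<open>c\<close>. Centering at the true mean rather
  than at the sample mean makes it an average of independent terms minus a pair average of centered
  ones.\<close>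

lemma sigma2_Y_hat_eq:
  assumes "2 \<le> n"
  shows "sigma2_Y_hat n y = (\<Sum>i=1..n. (y i - c)\<^sup>2) / real n
    - (\<Sum>k=1..n. \<Sum>i=1..<k. (y i - c) * (y k - c)) / real (n choose 2)"
proof -
  define z where "z i = y i - c" for i
  define s q P where "s = (\<Sum>i=1..n. z i)" and "q = (\<Sum>i=1..n. (z i)\<^sup>2)"
    and "P = (\<Sum>k=1..n. \<Sum>i=1..<k. z i * z k)"
  have n: "real n > 0" "real n - 1 > 0" using assms by auto
  have mean: "sample_mean n y = c + s / n"
    using n by (simp add: sample_mean_def s_def z_def sum_subtractf field_simps)
  have "(y i - sample_mean n y)\<^sup>2 = (z i)\<^sup>2 + (s/n)\<^sup>2 - 2 * (s / n) * z i" for i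
  proof -
    have "y i - sample_mean n y = z i - s / n"
      unfolding mean z_def by simp
    then show ?thesis by (simp add: power2_diff)
  qed
  then have "(\<Sum>i=1..n. (y i - sample_mean n y)\<^sup>2) = (\<Sum>i=1..n. (z i)\<^sup>2 + (s/n)\<^sup>2 - 2 * (s / n) * z i)"
    by simp
  also have "\<dots> = q + n * (s / n)\<^sup>2 - 2 * (s / n) * s"
    unfolding sum_subtractf sum.distrib by (simp add: sum_distrib_left q_def s_def)
  also have "\<dots> = q - s\<^sup>2 / n"
    using n by (simp add: power2_eq_square)
  also have "s\<^sup>2 = q + 2 * P"
    unfolding s_def q_def P_def by (rule power2_sum_eq_pairs)
  finally have "sigma2_Y_hat n y = 1 / (real n - 1) * (q - (q + 2 * P) / n)"
    by (simp add: sigma2_Y_hat_def)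
  also have "\<dots> = q / n - P / real (n choose 2)"
    unfolding real_choose_two using n by (simp add: divide_simps) (simp add: algebra_simps)
  finally show ?thesis by (simp add: q_def P_def z_def)
qed

text \<open>Hoeffding decomposition of the \<open>U\<close>-statistic: with \<open>W\<^sub>i = v\<^sub>i + b\<close>, each inner product
  \<open>\<langle>W\<^sub>i, W\<^sub>k\<rangle>\<close> splits into a constant, two terms that depend on one observation, and the completely
  degenerate part \<open>\<langle>v\<^sub>i, v\<^sub>k\<rangle>\<close>.\<close>

lemma tau2_hat_eq:
  assumes "2 \<le> n" and v: "\<And>i j. j < p \<Longrightarrow> v i j = x i j * y i - b j"
  shows "tau2_hat n p x y = inner_vec p b b + 2 / real n * (\<Sum>i=1..n. inner_vec p b (v i))
    + (\<Sum>k=1..n. \<Sum>i=1..<k. inner_vec p (v i) (v k)) / real (n choose 2)"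
proof -
  have n: "real n > 0" "real n - 1 > 0" using assms by auto
  have "inner_vec p (Wvec (x i) (y i)) (Wvec (x k) (y k)) =
      inner_vec p (v i) (v k) + (inner_vec p b (v i) + inner_vec p b (v k)) + inner_vec p b b" for i k
  proof -
    have "inner_vec p (Wvec (x i) (y i)) (Wvec (x k) (y k)) = (\<Sum>j<p. (v i j + b j) * (v k j + b j))"
      unfolding inner_vec_def Wvec_def by (intro sum.cong refl) (simp add: v)
    then show ?thesis by (simp add: inner_vec_def algebra_simps sum.distrib)
  qed
  then have "tau2_hat n p x y = inverse (real (n choose 2)) * ((\<Sum>k=1..n. \<Sum>i=1..<k. inner_vec p (v i) (v k))
     + (\<Sum>k=1..n. \<Sum>i=1..<k. inner_vec p b (v i) + inner_vec p b (v k)) + (\<Sum>k=1..n. \<Sum>i=1..<k. inner_vec p b b))"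
    unfolding tau2_hat_def sum_over_pairs by (simp only: sum.distrib)
  then show ?thesis
    unfolding sum_pairs_add sum_pairs_const
    unfolding real_choose_two using n by (simp add: divide_simps) (simp add: algebra_simps)
qed

section \<open>Population quantities\<close>

context model_free_sample
begin

lemma measurable_X_coordinate: "j < p \<Longrightarrow> (\<lambda>\<omega>. X \<omega> j) \<in> borel_measurable M"
  by (rule measurable_compose[OF measurable_X, where g = "\<lambda>v. v j"]) auto

lemma integrable_X: "j < p \<Longrightarrow> integrable M (\<lambda>\<omega>. X \<omega> j)"
  using measurable_X_coordinate integrable_X2 by (rule square_integrable_imp_integrable)

lemma integrable_Y: "integrable M Y"
  using measurable_Y integrable_Y2 by (rule square_integrable_imp_integrable)

lemma moment_XX:
  assumes "j < p" "l < p"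
  shows "has_bochner_integral M (\<lambda>\<omega>. X \<omega> j * X \<omega> l) (if j = l then 1 else 0)"
  using covariance_X[OF assms] assms
  by (simp add: has_bochner_integral_iff integrable_mult_of_squares measurable_X_coordinate
      integrable_X2 mean_X)

lemma integrable_XY: "j < p \<Longrightarrow> integrable M (\<lambda>\<omega>. X \<omega> j * Y \<omega>)"
  by (intro integrable_mult_of_squares measurable_X_coordinate measurable_Y integrable_X2 integrable_Y2)

text \<open>Because \<open>X\<close> has mean zero and identity covariance, the loss separates into a function of \<open>a\<close>
  and one function of each coordinate of \<open>b\<close>. This is what makes the minimiser explicit, and the same
  formula at the minimiser gives the residual variance.\<close>

lemma quadratic_loss:
  "has_bochner_integral M (\<lambda>\<omega>. (Y \<omega> - a - inner_vec p b (X \<omega>))\<^sup>2)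
    (expectation (\<lambda>\<omega>. (Y \<omega>)\<^sup>2) - 2 * a * expectation Y + a\<^sup>2
      + (\<Sum>j<p. (b j)\<^sup>2 - 2 * b j * expectation (\<lambda>\<omega>. X \<omega> j * Y \<omega>)))"
proof -
  have "has_bochner_integral M (\<lambda>\<omega>. (Y \<omega>)\<^sup>2 - 2 * a * Y \<omega> + a\<^sup>2
      + (\<Sum>j<p. 2 * a * b j * X \<omega> j - 2 * b j * (X \<omega> j * Y \<omega>))
      + (\<Sum>j<p. \<Sum>l<p. (b j * b l) * (X \<omega> j * X \<omega> l)))
    (expectation (\<lambda>\<omega>. (Y \<omega>)\<^sup>2) - 2 * a * expectation Y + a\<^sup>2
      + (\<Sum>j<p. 2 * a * b j * 0 - 2 * b j * expectation (\<lambda>\<omega>. X \<omega> j * Y \<omega>))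
      + (\<Sum>j<p. \<Sum>l<p. (b j * b l) * (if j = l then 1 else 0)))"
  proof (intro has_bochner_integral_add has_bochner_integral_sum has_bochner_integral_diff
      has_bochner_integral_mult_right moment_XX)
    show "has_bochner_integral M (\<lambda>\<omega>. a\<^sup>2) (a\<^sup>2)"
      by (simp add: has_bochner_integral_iff prob_space)
  qed (auto simp: has_bochner_integral_iff integrable_Y integrable_Y2 integrable_X integrable_XY mean_X)
  also have "(\<lambda>\<omega>. (Y \<omega>)\<^sup>2 - 2 * a * Y \<omega> + a\<^sup>2
      + (\<Sum>j<p. 2 * a * b j * X \<omega> j - 2 * b j * (X \<omega> j * Y \<omega>))
      + (\<Sum>j<p. \<Sum>l<p. (b j * b l) * (X \<omega> j * X \<omega> l))) = (\<lambda>\<omega>. (Y \<omega> - a - inner_vec p b (X \<omega>))\<^sup>2)"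
  proof
    fix \<omega>
    have "(\<Sum>j<p. 2 * a * b j * X \<omega> j - 2 * b j * (X \<omega> j * Y \<omega>)) = 2 * (a - Y \<omega>) * inner_vec p b (X \<omega>)"
      unfolding inner_vec_def sum_distrib_left by (intro sum.cong refl) (simp add: algebra_simps)
    then show "(Y \<omega>)\<^sup>2 - 2 * a * Y \<omega> + a\<^sup>2
      + (\<Sum>j<p. 2 * a * b j * X \<omega> j - 2 * b j * (X \<omega> j * Y \<omega>))
      + (\<Sum>j<p. \<Sum>l<p. (b j * b l) * (X \<omega> j * X \<omega> l)) = (Y \<omega> - a - inner_vec p b (X \<omega>))\<^sup>2"
      unfolding inner_vec_power2[symmetric] by (simp add: power2_eq_square algebra_simps)
  qed
  also have "(\<Sum>j<p. \<Sum>l<p. (b j * b l) * (if j = l then 1 else 0)) = (\<Sum>j<p. (b j)\<^sup>2)"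
    by (simp add: if_distrib[of "\<lambda>x. _ * x"] power2_eq_square cong: if_cong)
  finally show ?thesis
    by (simp add: sum_subtractf sum_negf algebra_simps)
qed

text \<open>Completing squares shows that the loss is a constant plus the squared distance to the claimed
  minimiser. Uniqueness is needed as well, since the operator \<open>arg_min_on\<close> selects an arbitrary
  minimiser; the selected one agrees with the claim outside \<open>{..<p}\<close> because both are extensional.\<close>

lemma best_linear_eq:
  "best_linear M p X Y = (expectation Y, \<lambda>j\<in>{..<p}. expectation (\<lambda>\<omega>. X \<omega> j * Y \<omega>))"
proof -
  define \<mu> where "\<mu> = expectation Y"
  define \<gamma> where "\<gamma> = (\<lambda>j\<in>{..<p}. expectation (\<lambda>\<omega>. X \<omega> j * Y \<omega>))"
  define K where "K = expectation (\<lambda>\<omega>. (Y \<omega>)\<^sup>2) - \<mu>\<^sup>2 - (\<Sum>j<p. (\<gamma> j)\<^sup>2)"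
  define f where "f = (\<lambda>(a, b). \<integral>\<omega>. (Y \<omega> - a - inner_vec p b (X \<omega>))\<^sup>2 \<partial>M)"
  have f: "f (a, b) = K + (a - \<mu>)\<^sup>2 + (\<Sum>j<p. (b j - \<gamma> j)\<^sup>2)" for a b
  proof -
    have "(\<Sum>j<p. (b j)\<^sup>2 - 2 * b j * expectation (\<lambda>\<omega>. X \<omega> j * Y \<omega>)) =
        (\<Sum>j<p. (b j - \<gamma> j)\<^sup>2 - (\<gamma> j)\<^sup>2)"
      by (intro sum.cong refl) (simp add: \<gamma>_def power2_eq_square algebra_simps)
    then have "f (a, b) = expectation (\<lambda>\<omega>. (Y \<omega>)\<^sup>2) - 2 * a * \<mu> + a\<^sup>2 + (\<Sum>j<p. (b j - \<gamma> j)\<^sup>2 - (\<gamma> j)\<^sup>2)"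
      using quadratic_loss[of a b, THEN has_bochner_integral_integral_eq]
      by (simp add: f_def \<mu>_def)
    then show ?thesis
      by (simp add: K_def sum_subtractf power2_diff[of a \<mu>])
  qed
  let ?S = "UNIV \<times> ({..<p} \<rightarrow>\<^sub>E UNIV) :: (real \<times> (nat \<Rightarrow> real)) set"
  have in_S: "(\<mu>, \<gamma>) \<in> ?S"
    by (simp add: \<gamma>_def)
  have "f (\<mu>, \<gamma>) \<le> f (a, b)" for a b
    unfolding f using sum_nonneg[of "{..<p}" "\<lambda>j. (b j - \<gamma> j)\<^sup>2"] by simp
  with in_S have "is_arg_min f (\<lambda>x. x \<in> ?S) (\<mu>, \<gamma>)"
    unfolding is_arg_min_linorder by (metis prod.collapse)
  then have arg: "is_arg_min f (\<lambda>x. x \<in> ?S) (arg_min_on f ?S)"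
    unfolding arg_min_on_def arg_min_def by (rule someI)
  obtain a b where ab: "arg_min_on f ?S = (a, b)" by force
  have "f (a, b) \<le> f (\<mu>, \<gamma>)"
    using arg in_S unfolding ab is_arg_min_linorder by blast
  then have le: "(a - \<mu>)\<^sup>2 + (\<Sum>j<p. (b j - \<gamma> j)\<^sup>2) \<le> 0"
    by (simp add: f)
  have nonneg: "0 \<le> (\<Sum>j<p. (b j - \<gamma> j)\<^sup>2)" "0 \<le> (a - \<mu>)\<^sup>2"
    by (simp_all add: sum_nonneg)
  with le have "(a - \<mu>)\<^sup>2 = 0" "(\<Sum>j<p. (b j - \<gamma> j)\<^sup>2) = 0"
    by linarith+
  then have "a = \<mu>" "\<And>j. j < p \<Longrightarrow> b j = \<gamma> j"
    by (auto simp: sum_nonneg_eq_0_iff)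
  moreover have "b \<in> {..<p} \<rightarrow>\<^sub>E UNIV" "\<gamma> \<in> {..<p} \<rightarrow>\<^sub>E UNIV"
    using arg in_S unfolding ab is_arg_min_linorder by blast+
  ultimately have "a = \<mu>" "b = \<gamma>"
    using PiE_ext[of b "{..<p}" "\<lambda>_. UNIV" \<gamma>] by auto
  with ab show ?thesis
    by (simp add: best_linear_def f_def \<mu>_def \<gamma>_def)
qed

abbreviation \<alpha> :: real where "\<alpha> \<equiv> alpha M p X Y"
abbreviation \<beta> :: "nat \<Rightarrow> real" where "\<beta> \<equiv> beta M p X Y"

lemma alpha_eq: "\<alpha> = expectation Y"
  by (simp add: alpha_def best_linear_eq)

lemma beta_eq: "j < p \<Longrightarrow> \<beta> j = expectation (\<lambda>\<omega>. X \<omega> j * Y \<omega>)"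
  by (simp add: beta_def best_linear_eq)

lemma tau2_eq: "tau2 M p X Y = (\<Sum>j<p. (\<beta> j)\<^sup>2)"
  by (simp add: tau2_def inner_vec_def power2_eq_square)

lemma variance_Y:
  "has_bochner_integral M (\<lambda>\<omega>. (Y \<omega> - \<alpha>)\<^sup>2) (variance Y)"
proof -
  have "integrable M (\<lambda>\<omega>. (Y \<omega>)\<^sup>2 - 2 * \<alpha> * Y \<omega> + \<alpha>\<^sup>2)"
    using integrable_Y integrable_Y2 by simp
  then show ?thesis
    by (simp add: has_bochner_integral_iff alpha_eq power2_diff algebra_simps)
qed

text \<open>Pythagoras: the residual is orthogonal to the linear part, whose variance is \<open>\<tau>\<^sup>2\<close> since
  \<open>X\<close> has identity covariance.\<close>

lemma sigma2_eq: "sigma2 M p X Y = variance Y - tau2 M p X Y"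
proof -
  have "has_bochner_integral M (residual M p X Y) (expectation Y - \<alpha> - (\<Sum>j<p. \<beta> j * expectation (\<lambda>\<omega>. X \<omega> j)))"
    unfolding residual_def[abs_def] inner_vec_def
    by (intro has_bochner_integral_diff has_bochner_integral_sum has_bochner_integral_mult_right)
      (auto simp: has_bochner_integral_iff integrable_Y integrable_X prob_space)
  then have "expectation (residual M p X Y) = 0"
    by (simp add: has_bochner_integral_iff mean_X alpha_eq)
  then have "sigma2 M p X Y = expectation (\<lambda>\<omega>. (Y \<omega> - \<alpha> - inner_vec p \<beta> (X \<omega>))\<^sup>2)"
    by (simp add: sigma2_def residual_def)
  also have "\<dots> = expectation (\<lambda>\<omega>. (Y \<omega>)\<^sup>2) - \<alpha>\<^sup>2 - tau2 M p X Y"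
    using quadratic_loss[of \<alpha> \<beta>, THEN has_bochner_integral_integral_eq]
    by (simp add: tau2_eq alpha_eq[symmetric] beta_eq[symmetric] power2_eq_square sum_negf mult.assoc)
  finally show ?thesis
    using variance_eq[OF integrable_Y integrable_Y2] by (simp add: alpha_eq)
qed

lemma measurable_sample: "i \<in> {1..n} \<Longrightarrow> (\<lambda>\<omega>. (Xs i \<omega>, Ys i \<omega>)) \<in> M \<rightarrow>\<^sub>M borel_vec p \<Otimes>\<^sub>M borel"
  using indep_sample by (auto simp: indep_vars_def)

lemma has_bochner_integral_copy:
  assumes i: "i \<in> {1..n}" and h: "h \<in> borel_measurable (borel_vec p \<Otimes>\<^sub>M borel)"
    and "has_bochner_integral M (\<lambda>\<omega>. h (X \<omega>, Y \<omega>)) c"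
  shows "has_bochner_integral M (\<lambda>\<omega>. h (Xs i \<omega>, Ys i \<omega>)) (c :: real)"
proof -
  have XY: "(\<lambda>\<omega>. (X \<omega>, Y \<omega>)) \<in> M \<rightarrow>\<^sub>M borel_vec p \<Otimes>\<^sub>M borel"
    using measurable_X measurable_Y by measurable
  show ?thesis
    using assms(3) identically_distributed[OF i]
    by (simp add: has_bochner_integral_iff
        integrable_distr_eq[OF measurable_sample[OF i] h, symmetric] integrable_distr_eq[OF XY h, symmetric]
        integral_distr[OF measurable_sample[OF i] h, symmetric] integral_distr[OF XY h, symmetric])
qed

end

section \<open>The mean squared error of the noise level estimator\<close>

locale model_free_sample_fourth_moments = model_free_sample +
  assumes integrable_Y4: "integrable M (\<lambda>\<omega>. (Y \<omega> - alpha M p X Y) ^ 4)"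
    and integrable_WW: "\<And>j k. j < p \<Longrightarrow> k < p \<Longrightarrow>
      integrable M (\<lambda>\<omega>. Wvec (X \<omega>) (Y \<omega>) j * Wvec (X \<omega>) (Y \<omega>) k)"
begin

abbreviation A :: "nat \<Rightarrow> nat \<Rightarrow> real" where "A \<equiv> A_mat M X Y"
abbreviation \<tau>2 :: real where "\<tau>2 \<equiv> tau2 M p X Y"
abbreviation \<mu>4 :: real where "\<mu>4 \<equiv> mu4 M p X Y"

text \<open>This is the covariance matrix \<open>E (W - \<beta>)(W - \<beta>)\<^sup>T\<close>, as \<open>covariance_centered_W\<close> shows.\<close>

definition cov_W :: "nat \<Rightarrow> nat \<Rightarrow> real" where
  "cov_W j l = A j l - \<beta> j * \<beta> l"

definition centered_W :: "(nat \<Rightarrow> real) \<times> real \<Rightarrow> nat \<Rightarrow> real" where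
  "centered_W = (\<lambda>(x, y). \<lambda>j\<in>{..<p}. Wvec x y j - \<beta> j)"

text \<open>The influence function of the estimator: the part of its error that is linear in the
  empirical distribution is the sample average of this function.\<close>

definition influence :: "(nat \<Rightarrow> real) \<times> real \<Rightarrow> real" where
  "influence = (\<lambda>(x, y). ((y - \<alpha>)\<^sup>2 - variance Y) - 2 * inner_vec p \<beta> (centered_W (x, y)))"

lemma centered_W_apply: "j < p \<Longrightarrow> centered_W (x, y) j = x j * y - \<beta> j"
  by (simp add: centered_W_def Wvec_def)

lemma measurable_centered_W: "centered_W \<in> borel_vec p \<Otimes>\<^sub>M borel \<rightarrow>\<^sub>M borel_vec p"
  unfolding centered_W_def Wvec_def case_prod_beta
  by (intro measurable_restrict) measurable

lemma measurable_centered_W_coordinate: "j < p \<Longrightarrow> (\<lambda>w. centered_W w j) \<in> borel_measurable (borel_vec p \<Otimes>\<^sub>M borel)"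
  by (rule measurable_compose[OF measurable_centered_W, where g = "\<lambda>v. v j"]) auto

lemma measurable_influence: "influence \<in> borel_measurable (borel_vec p \<Otimes>\<^sub>M borel)"
  unfolding influence_def inner_vec_def case_prod_beta prod.collapse
  by (intro borel_measurable_diff borel_measurable_times borel_measurable_sum borel_measurable_power
      borel_measurable_const measurable_centered_W_coordinate measurable_snd) auto

lemma moment_W: "j < p \<Longrightarrow> has_bochner_integral M (\<lambda>\<omega>. X \<omega> j * Y \<omega>) (\<beta> j)"
  by (simp add: has_bochner_integral_iff integrable_XY beta_eq)

lemma mean_centered_W: "j < p \<Longrightarrow> has_bochner_integral M (\<lambda>\<omega>. centered_W (X \<omega>, Y \<omega>) j) 0"
proof -
  assume j: "j < p"
  have "has_bochner_integral M (\<lambda>\<omega>. X \<omega> j * Y \<omega> - \<beta> j) (\<beta> j - \<beta> j)"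
    by (intro has_bochner_integral_diff moment_W j) (simp add: has_bochner_integral_iff prob_space)
  then show ?thesis using j by (simp add: centered_W_apply)
qed

lemma covariance_centered_W:
  assumes "j < p" "l < p"
  shows "has_bochner_integral M (\<lambda>\<omega>. centered_W (X \<omega>, Y \<omega>) j * centered_W (X \<omega>, Y \<omega>) l) (cov_W j l)"
proof -
  have "has_bochner_integral M (\<lambda>\<omega>. Wvec (X \<omega>) (Y \<omega>) j * Wvec (X \<omega>) (Y \<omega>) l
      - \<beta> l * (X \<omega> j * Y \<omega>) - \<beta> j * (X \<omega> l * Y \<omega>) + \<beta> j * \<beta> l)
      (A j l - \<beta> l * \<beta> j - \<beta> j * \<beta> l + \<beta> j * \<beta> l)"
    using integrable_WW[OF assms]
    by (intro has_bochner_integral_diff has_bochner_integral_add has_bochner_integral_mult_right moment_W assms)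
      (simp_all add: has_bochner_integral_iff prob_space A_mat_def)
  then show ?thesis
    using assms by (simp add: centered_W_apply Wvec_def cov_W_def algebra_simps)
qed

lemma variance_projected_W:
  "has_bochner_integral M (\<lambda>\<omega>. (inner_vec p \<beta> (centered_W (X \<omega>, Y \<omega>)))\<^sup>2)
    ((\<Sum>j<p. \<Sum>l<p. \<beta> j * \<beta> l * A j l) - \<tau>2\<^sup>2)"
proof -
  have "(\<Sum>j<p. \<Sum>l<p. \<beta> j * \<beta> l * cov_W j l) = (\<Sum>j<p. \<Sum>l<p. \<beta> j * \<beta> l * A j l) - \<tau>2\<^sup>2"
    unfolding cov_W_def tau2_eq power2_eq_square[of "sum _ _"] sum_product
    by (simp add: sum_subtractf[symmetric] power2_eq_square algebra_simps)
  moreover have "has_bochner_integral M (\<lambda>\<omega>. (inner_vec p \<beta> (centered_W (X \<omega>, Y \<omega>)))\<^sup>2)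
      (\<Sum>j<p. \<Sum>l<p. \<beta> j * \<beta> l * cov_W j l)"
    unfolding inner_vec_power2
    by (intro has_bochner_integral_sum has_bochner_integral_mult_right covariance_centered_W) auto
  ultimately show ?thesis by simp
qed

text \<open>Cauchy-Schwarz for the Frobenius inner product of \<open>\<beta> \<beta>\<^sup>T\<close> and \<open>A\<close>.\<close>

lemma projected_W_le_frobenius:
  "(\<Sum>j<p. \<Sum>l<p. \<beta> j * \<beta> l * A j l) \<le> \<tau>2 * frobenius_norm p A"
proof -
  let ?I = "{..<p} \<times> {..<p}"
  have "(\<Sum>j<p. \<Sum>l<p. \<beta> j * \<beta> l * A j l) = (\<Sum>(j, l)\<in>?I. (\<beta> j * \<beta> l) * A j l)"
    by (simp add: sum.cartesian_product)
  also have "\<dots> \<le> sqrt ((\<Sum>(j, l)\<in>?I. (\<beta> j * \<beta> l)\<^sup>2) * (\<Sum>(j, l)\<in>?I. (A j l)\<^sup>2))"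
    using Cauchy_Schwarz_ineq_sum[of "\<lambda>(j, l). \<beta> j * \<beta> l" "\<lambda>(j, l). A j l" ?I]
    by (intro real_le_rsqrt) (simp add: case_prod_beta)
  also have "(\<Sum>(j, l)\<in>?I. (\<beta> j * \<beta> l)\<^sup>2) = \<tau>2\<^sup>2"
    unfolding tau2_eq power2_eq_square[of "sum _ _"] sum_product
    by (simp add: sum.cartesian_product power_mult_distrib)
  also have "sqrt (\<tau>2\<^sup>2 * (\<Sum>(j, l)\<in>?I. (A j l)\<^sup>2)) = \<tau>2 * frobenius_norm p A"
    by (simp add: real_sqrt_mult frobenius_norm_def sum.cartesian_product tau2_eq sum_nonneg)
  finally show ?thesis .
qed

text \<open>Centering does not increase the Frobenius norm: expanding the square gives
  \<open>\<parallel>A\<parallel>\<^sup>2 - 2 \<beta>\<^sup>T A \<beta> + \<tau>\<^sup>4\<close>, and \<open>\<beta>\<^sup>T A \<beta> \<ge> \<tau>\<^sup>4\<close> because the difference is the variance of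
  \<open>\<beta>\<^sup>T W\<close>.\<close>

lemma frobenius_covariance_le: "(\<Sum>j<p. \<Sum>l<p. (cov_W j l)\<^sup>2) \<le> (frobenius_norm p A)\<^sup>2"
proof -
  have "0 \<le> (\<Sum>j<p. \<Sum>l<p. \<beta> j * \<beta> l * A j l) - \<tau>2\<^sup>2"
    unfolding has_bochner_integral_integral_eq[OF variance_projected_W, symmetric] by simp
  moreover have "(\<Sum>j<p. \<Sum>l<p. (\<beta> j * \<beta> l)\<^sup>2) = \<tau>2\<^sup>2"
    unfolding tau2_eq power2_eq_square[of "sum _ _"] sum_product by (simp add: power_mult_distrib)
  moreover have "(\<Sum>j<p. \<Sum>l<p. (cov_W j l)\<^sup>2) = (\<Sum>j<p. \<Sum>l<p. (A j l)\<^sup>2)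
      - 2 * (\<Sum>j<p. \<Sum>l<p. \<beta> j * \<beta> l * A j l) + (\<Sum>j<p. \<Sum>l<p. (\<beta> j * \<beta> l)\<^sup>2)"
    unfolding sum_distrib_left sum_subtractf[symmetric] sum.distrib[symmetric] cov_W_def
    by (intro sum.cong refl) (simp add: power2_eq_square algebra_simps)
  moreover have "(frobenius_norm p A)\<^sup>2 = (\<Sum>j<p. \<Sum>l<p. (A j l)\<^sup>2)"
    by (simp add: frobenius_norm_def sum_nonneg)
  moreover have "0 \<le> \<tau>2\<^sup>2" by simp
  ultimately show ?thesis by linarith
qed

lemma variance_squared_Y:
  "has_bochner_integral M (\<lambda>\<omega>. ((Y \<omega> - \<alpha>)\<^sup>2 - variance Y)\<^sup>2) (\<mu>4 - (variance Y)\<^sup>2)"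
proof -
  have "has_bochner_integral M (\<lambda>\<omega>. (Y \<omega> - \<alpha>) ^ 4 - 2 * variance Y * (Y \<omega> - \<alpha>)\<^sup>2 + (variance Y)\<^sup>2)
    (\<mu>4 - 2 * variance Y * variance Y + (variance Y)\<^sup>2)"
    using integrable_Y4
    by (intro has_bochner_integral_diff has_bochner_integral_add has_bochner_integral_mult_right variance_Y)
      (simp_all add: has_bochner_integral_iff prob_space mu4_def)
  moreover have "(Y \<omega> - \<alpha>) ^ 4 - 2 * variance Y * (Y \<omega> - \<alpha>)\<^sup>2 + (variance Y)\<^sup>2
      = ((Y \<omega> - \<alpha>)\<^sup>2 - variance Y)\<^sup>2" for \<omega>
    unfolding power2_diff[of _ "variance Y"] by (simp add: power_mult[symmetric])
  moreover have "\<mu>4 - 2 * variance Y * variance Y + (variance Y)\<^sup>2 = \<mu>4 - (variance Y)\<^sup>2"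
    by (simp add: power2_eq_square)
  ultimately show ?thesis by simp
qed

lemma variance_Y_power2_le: "(variance Y)\<^sup>2 \<le> \<mu>4"
proof -
  have "0 \<le> \<mu>4 - (variance Y)\<^sup>2"
    unfolding has_bochner_integral_integral_eq[OF variance_squared_Y, symmetric] by simp
  then show ?thesis by simp
qed

lemma measurable_pair: "(\<lambda>\<omega>. (X \<omega>, Y \<omega>)) \<in> M \<rightarrow>\<^sub>M borel_vec p \<Otimes>\<^sub>M borel"
  using measurable_X measurable_Y by measurable

lemma influence_power2_le: "(influence (x, y))\<^sup>2 \<le> 2 * ((y - \<alpha>)\<^sup>2 - variance Y)\<^sup>2 + 8 * (inner_vec p \<beta> (centered_W (x, y)))\<^sup>2"
proof -
  \<comment> \<open>the difference of the two sides is \<open>(a + 2 b)\<^sup>2\<close>\<close>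
  have "(a - 2 * b)\<^sup>2 \<le> 2 * a\<^sup>2 + 8 * b\<^sup>2" for a b :: real
    using zero_le_power2[of "a + 2 * b"] by (simp add: power2_eq_square algebra_simps)
  then show ?thesis by (simp add: influence_def)
qed

lemma second_moment_influence:
  "integrable M (\<lambda>\<omega>. (influence (X \<omega>, Y \<omega>))\<^sup>2)"
  "expectation (\<lambda>\<omega>. (influence (X \<omega>, Y \<omega>))\<^sup>2) \<le> 2 * \<mu>4 + 8 * (\<tau>2 * frobenius_norm p A)"
proof -
  have meas: "(\<lambda>\<omega>. (influence (X \<omega>, Y \<omega>))\<^sup>2) \<in> borel_measurable M"
    by (intro borel_measurable_power measurable_compose[OF measurable_pair measurable_influence])
  let ?B = "\<lambda>\<omega>. 2 * ((Y \<omega> - \<alpha>)\<^sup>2 - variance Y)\<^sup>2 + 8 * (inner_vec p \<beta> (centered_W (X \<omega>, Y \<omega>)))\<^sup>2"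
  have B: "has_bochner_integral M ?B (2 * (\<mu>4 - (variance Y)\<^sup>2)
      + 8 * ((\<Sum>j<p. \<Sum>l<p. \<beta> j * \<beta> l * A j l) - \<tau>2\<^sup>2))"
    by (intro has_bochner_integral_add has_bochner_integral_mult_right variance_squared_Y variance_projected_W)
  show int: "integrable M (\<lambda>\<omega>. (influence (X \<omega>, Y \<omega>))\<^sup>2)"
    using B influence_power2_le by (intro Bochner_Integration.integrable_bound[OF _ meas, of ?B])
      (auto simp: has_bochner_integral_iff)
  have "expectation (\<lambda>\<omega>. (influence (X \<omega>, Y \<omega>))\<^sup>2) \<le> expectation ?B"
    using B influence_power2_le int by (intro integral_mono) (auto simp: has_bochner_integral_iff)
  also have "\<dots> = 2 * (\<mu>4 - (variance Y)\<^sup>2) + 8 * ((\<Sum>j<p. \<Sum>l<p. \<beta> j * \<beta> l * A j l) - \<tau>2\<^sup>2)"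
    using B by (rule has_bochner_integral_integral_eq)
  also have "\<dots> \<le> 2 * \<mu>4 + 8 * (\<tau>2 * frobenius_norm p A)"
    using projected_W_le_frobenius zero_le_power2[of "variance Y"] zero_le_power2[of \<tau>2] by argo
  finally show "expectation (\<lambda>\<omega>. (influence (X \<omega>, Y \<omega>))\<^sup>2) \<le> 2 * \<mu>4 + 8 * (\<tau>2 * frobenius_norm p A)" .
qed

lemma mean_influence: "has_bochner_integral M (\<lambda>\<omega>. influence (X \<omega>, Y \<omega>)) 0"
proof -
  have "has_bochner_integral M (\<lambda>\<omega>. influence (X \<omega>, Y \<omega>)) ((variance Y - variance Y) - 2 * (\<Sum>j<p. \<beta> j * 0))"
    unfolding influence_def inner_vec_def split
    by (intro has_bochner_integral_diff has_bochner_integral_mult_right has_bochner_integral_sum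
        variance_Y mean_centered_W) (auto simp: has_bochner_integral_iff prob_space)
  then show ?thesis by simp
qed

interpretation W: independent_centered_vectors M n p "\<lambda>i \<omega>. centered_W (Xs i \<omega>, Ys i \<omega>)" cov_W
proof
  show "indep_vars (\<lambda>_. borel_vec p) (\<lambda>i \<omega>. centered_W (Xs i \<omega>, Ys i \<omega>)) {1..n}"
    by (rule indep_vars_compose2[OF indep_sample, where Y = "\<lambda>_. centered_W"]) (rule measurable_centered_W)
next
  fix i j assume ij: "i \<in> {1..n}" "j < p"
  note meas = measurable_centered_W_coordinate[OF ij(2)]
  show "integrable M (\<lambda>\<omega>. (centered_W (Xs i \<omega>, Ys i \<omega>) j)\<^sup>2)"
    using has_bochner_integral_copy[OF ij(1), where h = "\<lambda>w. centered_W w j * centered_W w j", OF borel_measurable_times[OF meas meas]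
        covariance_centered_W[OF ij(2) ij(2)]]
    by (simp add: has_bochner_integral_iff power2_eq_square)
  show "expectation (\<lambda>\<omega>. centered_W (Xs i \<omega>, Ys i \<omega>) j) = 0"
    using has_bochner_integral_copy[OF ij(1), where h = "\<lambda>w. centered_W w j", OF meas mean_centered_W[OF ij(2)]]
    by (simp add: has_bochner_integral_iff)
next
  fix i j l assume ij: "i \<in> {1..n}" "j < p" "l < p"
  show "expectation (\<lambda>\<omega>. centered_W (Xs i \<omega>, Ys i \<omega>) j * centered_W (Xs i \<omega>, Ys i \<omega>) l) = cov_W j l"
    using has_bochner_integral_copy[OF ij(1), where h = "\<lambda>w. centered_W w j * centered_W w l",
        OF borel_measurable_times[OF ij(2,3)[THEN measurable_centered_W_coordinate]] covariance_centered_W[OF ij(2,3)]]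
    by (simp add: has_bochner_integral_iff)
qed

text \<open>All terms of first order are collected in the influence function, and the population values
  \<open>Var(Y)\<close> and \<open>\<tau>\<^sup>2\<close> cancel, so that only centered quantities remain on the right. For \<open>n < 2\<close> there
  are no pairs and the estimators are degenerate.\<close>

lemma estimation_error:
  assumes "2 \<le> n"
  shows "sigma2_hat n p (\<lambda>i. Xs i \<omega>) (\<lambda>i. Ys i \<omega>) - sigma2 M p X Y =
    (\<Sum>i=1..n. influence (Xs i \<omega>, Ys i \<omega>)) / n
    - (\<Sum>k=1..n. \<Sum>i=1..<k. (Ys i \<omega> - \<alpha>) * (Ys k \<omega> - \<alpha>)) / (n choose 2)
    - (\<Sum>k=1..n. \<Sum>i=1..<k. inner_vec p (centered_W (Xs i \<omega>, Ys i \<omega>)) (centered_W (Xs k \<omega>, Ys k \<omega>))) / (n choose 2)"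
proof -
  have n: "real n \<noteq> 0" using assms by simp
  have "(\<Sum>i=1..n. influence (Xs i \<omega>, Ys i \<omega>)) / n = (\<Sum>i=1..n. (Ys i \<omega> - \<alpha>)\<^sup>2) / n - variance Y
      - 2 / n * (\<Sum>i=1..n. inner_vec p \<beta> (centered_W (Xs i \<omega>, Ys i \<omega>)))"
    unfolding influence_def split sum_subtractf sum_distrib_left[symmetric] using n
    by (simp add: diff_divide_distrib)
  moreover note tau2_hat = tau2_hat_eq[OF assms, where b = \<beta> and v = "\<lambda>i. centered_W (Xs i \<omega>, Ys i \<omega>)"
      and x = "\<lambda>i. Xs i \<omega>" and y = "\<lambda>i. Ys i \<omega>", OF centered_W_apply]
  ultimately show ?thesis
    unfolding sigma2_hat_def sigma2_Y_hat_eq[OF assms, where c = \<alpha>] sigma2_eq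
      tau2_hat tau2_def
    by simp
qed

text \<open>The squared error is at most three times the sum of the squares of the three terms of
  \<open>estimation_error\<close>, so their correlations do not matter. A sum of \<open>n\<close> centered independent variables
  contributes order \<open>1 / n\<close>, a sum over pairs order \<open>1 / n\<^sup>2\<close>.\<close>

theorem mean_squared_error:
  assumes n: "2 \<le> n"
  defines "D \<equiv> \<lambda>\<omega>. sigma2_hat n p (\<lambda>i. Xs i \<omega>) (\<lambda>i. Ys i \<omega>) - sigma2 M p X Y"
  shows "D \<in> borel_measurable M" and "integrable M (\<lambda>\<omega>. (D \<omega>)\<^sup>2)"
    and "expectation (\<lambda>\<omega>. (D \<omega>)\<^sup>2) \<le> 3 * ((2 * \<mu>4 + 8 * (\<tau>2 * frobenius_norm p A)) / n
      + (\<mu>4 + (frobenius_norm p A)\<^sup>2) / (n choose 2))"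
proof -
  define N where "N = real (n choose 2)"
  have N: "N > 0" using n by (simp add: N_def)
  define S1 where "S1 \<omega> = (\<Sum>i=1..n. influence (Xs i \<omega>, Ys i \<omega>))" for \<omega>
  define S2 where "S2 \<omega> = (\<Sum>k=1..n. \<Sum>i=1..<k. (Ys i \<omega> - \<alpha>) * (Ys k \<omega> - \<alpha>))" for \<omega>
  define S3 where "S3 \<omega> = (\<Sum>k=1..n. \<Sum>i=1..<k. inner_vec p (centered_W (Xs i \<omega>, Ys i \<omega>)) (centered_W (Xs k \<omega>, Ys k \<omega>)))" for \<omega>
  have D: "D = (\<lambda>\<omega>. S1 \<omega> / n - S2 \<omega> / N - S3 \<omega> / N)"
    unfolding D_def estimation_error[OF n] S1_def S2_def S3_def N_def ..
  have influence: "integrable M (\<lambda>\<omega>. (S1 \<omega>)\<^sup>2)"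
    "expectation (\<lambda>\<omega>. (S1 \<omega>)\<^sup>2) = n * expectation (\<lambda>\<omega>. (influence (X \<omega>, Y \<omega>))\<^sup>2)"
  proof -
    let ?U = "\<lambda>i \<omega>. influence (Xs i \<omega>, Ys i \<omega>)"
    have ind: "indep_vars (\<lambda>_. borel) ?U {1..n}"
      by (rule indep_vars_compose2[OF indep_sample, where Y = "\<lambda>_. influence"]) (rule measurable_influence)
    have sq: "has_bochner_integral M (\<lambda>\<omega>. (?U i \<omega>)\<^sup>2) (expectation (\<lambda>\<omega>. (influence (X \<omega>, Y \<omega>))\<^sup>2))"
      if "i \<in> {1..n}" for i
      using second_moment_influence(1) measurable_influence
      by (intro has_bochner_integral_copy[OF that, where h = "\<lambda>w. (influence w)\<^sup>2"]) (auto simp: has_bochner_integral_iff)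
    have mean: "expectation (?U i) = 0" if "i \<in> {1..n}" for i
      using has_bochner_integral_copy[OF that measurable_influence mean_influence] by (simp add: has_bochner_integral_iff)
    show "integrable M (\<lambda>\<omega>. (S1 \<omega>)\<^sup>2)"
      "expectation (\<lambda>\<omega>. (S1 \<omega>)\<^sup>2) = n * expectation (\<lambda>\<omega>. (influence (X \<omega>, Y \<omega>))\<^sup>2)"
      unfolding S1_def using scalar_second_moments(1,2)[OF ind _ mean] sq
      by (auto simp: has_bochner_integral_iff)
  qed
  have Z: "integrable M (\<lambda>\<omega>. (S2 \<omega>)\<^sup>2)" "expectation (\<lambda>\<omega>. (S2 \<omega>)\<^sup>2) = N * (variance Y)\<^sup>2"
  proof -
    let ?U = "\<lambda>i \<omega>. Ys i \<omega> - \<alpha>"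
    have meas: "(\<lambda>w. snd w - \<alpha>) \<in> borel_measurable (borel_vec p \<Otimes>\<^sub>M borel)"
      by measurable
    have ind: "indep_vars (\<lambda>_. borel) ?U {1..n}"
      using indep_vars_compose2[OF indep_sample, where Y = "\<lambda>_ w. snd w - \<alpha>" and N = "\<lambda>_. borel"] meas by simp
    have sq: "has_bochner_integral M (\<lambda>\<omega>. (?U i \<omega>)\<^sup>2) (variance Y)" if "i \<in> {1..n}" for i
      using has_bochner_integral_copy[OF that, where h = "\<lambda>w. (snd w - \<alpha>)\<^sup>2"] meas variance_Y by simp
    have "has_bochner_integral M (\<lambda>\<omega>. Y \<omega> - \<alpha>) 0"
      using integrable_Y by (simp add: has_bochner_integral_iff alpha_eq prob_space)
    then have mean: "expectation (?U i) = 0" if "i \<in> {1..n}" for i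
      using has_bochner_integral_copy[OF that meas] by (simp add: has_bochner_integral_iff)
    show "integrable M (\<lambda>\<omega>. (S2 \<omega>)\<^sup>2)" "expectation (\<lambda>\<omega>. (S2 \<omega>)\<^sup>2) = N * (variance Y)\<^sup>2"
      unfolding S2_def N_def using scalar_second_moments(3,4)[OF ind _ mean] sq
      by (auto simp: has_bochner_integral_iff)
  qed
  have W: "integrable M (\<lambda>\<omega>. (S3 \<omega>)\<^sup>2)"
    "expectation (\<lambda>\<omega>. (S3 \<omega>)\<^sup>2) = N * (\<Sum>j<p. \<Sum>l<p. (cov_W j l)\<^sup>2)"
    using W.second_moment_pair_sum[of n] by (simp_all add: W.pair_sum_def S3_def N_def)
  have sample: "(\<lambda>\<omega>. f (Xs i \<omega>, Ys i \<omega>)) \<in> borel_measurable M"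
    if "i \<in> {1..n}" "f \<in> borel_measurable (borel_vec p \<Otimes>\<^sub>M borel)" for i and f :: "_ \<Rightarrow> real"
    using measurable_sample[OF that(1)] that(2) by (rule measurable_compose)
  have S1: "S1 \<in> borel_measurable M"
    unfolding S1_def[abs_def] using sample measurable_influence by (intro borel_measurable_sum) auto
  have S2: "S2 \<in> borel_measurable M"
    unfolding S2_def[abs_def]
    using sample[of _ "\<lambda>w. snd w - \<alpha>"] by (intro borel_measurable_sum borel_measurable_times) auto
  have S3: "S3 \<in> borel_measurable M"
    using W.measurable_pair_sum[of n] by (simp add: W.pair_sum_def[abs_def] S3_def[abs_def])
  show Dm: "D \<in> borel_measurable M"
    unfolding D using S1 S2 S3 by simp
  let ?B = "\<lambda>\<omega>. 3 * ((S1 \<omega>)\<^sup>2 / (real n)\<^sup>2 + (S2 \<omega>)\<^sup>2 / N\<^sup>2 + (S3 \<omega>)\<^sup>2 / N\<^sup>2)"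
  have B: "integrable M ?B"
    using influence Z W by simp
  have le: "(D \<omega>)\<^sup>2 \<le> ?B \<omega>" for \<omega>
  proof -
    \<comment> \<open>the difference of the two sides is \<open>(a + b)\<^sup>2 + (a + c)\<^sup>2 + (b - c)\<^sup>2\<close>\<close>
    have "(a - b - c)\<^sup>2 \<le> 3 * (a\<^sup>2 + b\<^sup>2 + c\<^sup>2)" for a b c :: real
      using zero_le_power2[of "a + b"] zero_le_power2[of "a + c"] zero_le_power2[of "b - c"]
      by (simp add: power2_eq_square algebra_simps)
    from this[of "S1 \<omega> / n" "S2 \<omega> / N" "S3 \<omega> / N"] show ?thesis
      by (simp add: D power_divide)
  qed
  show int: "integrable M (\<lambda>\<omega>. (D \<omega>)\<^sup>2)"
    using B le Dm by (intro Bochner_Integration.integrable_bound[OF B]) (auto intro: order_trans)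
  have "expectation (\<lambda>\<omega>. (D \<omega>)\<^sup>2) \<le> expectation ?B"
    using int B le by (intro integral_mono) auto
  also have "\<dots> = 3 * (n * expectation (\<lambda>\<omega>. (influence (X \<omega>, Y \<omega>))\<^sup>2) / (real n)\<^sup>2
      + N * (variance Y)\<^sup>2 / N\<^sup>2 + N * (\<Sum>j<p. \<Sum>l<p. (cov_W j l)\<^sup>2) / N\<^sup>2)"
    using influence Z W by simp
  also have "\<dots> = 3 * (expectation (\<lambda>\<omega>. (influence (X \<omega>, Y \<omega>))\<^sup>2) / n
      + ((variance Y)\<^sup>2 + (\<Sum>j<p. \<Sum>l<p. (cov_W j l)\<^sup>2)) / N)"
    using n N by (simp add: power2_eq_square[of "real n"] power2_eq_square[of N] add_divide_distrib)
  also have "\<dots> \<le> 3 * ((2 * \<mu>4 + 8 * (\<tau>2 * frobenius_norm p A)) / n + (\<mu>4 + (frobenius_norm p A)\<^sup>2) / N)"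
    using second_moment_influence(2) variance_Y_power2_le frobenius_covariance_le N
    by (intro mult_left_mono add_mono divide_right_mono) auto
  finally show "expectation (\<lambda>\<omega>. (D \<omega>)\<^sup>2) \<le> 3 * ((2 * \<mu>4 + 8 * (\<tau>2 * frobenius_norm p A)) / n
      + (\<mu>4 + (frobenius_norm p A)\<^sup>2) / (n choose 2))"
    by (simp add: N_def)
qed

end

section \<open>Consistency\<close>

text \<open>The hypothesis on \<open>F = \<parallel>A\<parallel>\<^sub>F\<close> is of second order, as the pair terms require; its square root
  \<open>F / n \<longlonglongrightarrow> 0\<close> is just what the term of order \<open>1 / n\<close> needs.\<close>

lemma error_bound_tendsto_0:
  fixes m t F :: "nat \<Rightarrow> real"
  assumes "bounded (range m)" "bounded (range t)" and F: "(\<lambda>n. (F n)\<^sup>2 / (real n)\<^sup>2) \<longlonglongrightarrow> 0"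
  shows "(\<lambda>n. 3 * ((2 * m n + 8 * (t n * F n)) / n + (m n + (F n)\<^sup>2) / (n choose 2))) \<longlonglongrightarrow> 0"
proof -
  obtain B where B: "\<And>n. norm (m n) \<le> B"
    using assms(1) by (auto simp: bounded_iff)
  obtain B' where B': "\<And>n. norm (t n) \<le> B'"
    using assms(2) by (auto simp: bounded_iff)
  have "(\<lambda>n. sqrt ((F n)\<^sup>2 / (real n)\<^sup>2)) \<longlonglongrightarrow> sqrt 0"
    using F by (rule tendsto_real_sqrt)
  then have F1: "(\<lambda>n. F n / n) \<longlonglongrightarrow> 0"
    by (simp add: real_sqrt_divide tendsto_rabs_zero_iff[of "\<lambda>n. F n / real n", symmetric])
  have inv: "(\<lambda>n. 1 / real n) \<longlonglongrightarrow> 0"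
    by (rule lim_1_over_n)
  \<comment> \<open>the quotient of \<open>n\<^sup>2\<close> by the number of pairs is \<open>2 n / (n - 1) = 2 + 2 / (n - 1)\<close>\<close>
  have ratio: "(\<lambda>n. 2 + 2 / (real n - 1)) \<longlonglongrightarrow> 2"
    by real_asymp
  have m1: "(\<lambda>n. (1 / real n) * m n) \<longlonglongrightarrow> 0"
    by (rule lim_null_mult_right_bounded[OF inv, where B = B]) (use B in auto)
  have t1: "(\<lambda>n. (F n / real n) * t n) \<longlonglongrightarrow> 0"
    by (rule lim_null_mult_right_bounded[OF F1, where B = B']) (use B' in auto)
  have "(\<lambda>n. 3 * (2 * (1 / real n * m n) + 8 * ((F n / real n) * t n)
      + (1 / real n * (1 / real n * m n) + (F n)\<^sup>2 / (real n)\<^sup>2) * (2 + 2 / (real n - 1))))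
    \<longlonglongrightarrow> 3 * (2 * 0 + 8 * 0 + (0 * 0 + 0) * 2)"
    by (intro tendsto_intros inv m1 t1 F ratio)
  then have lim: "(\<lambda>n. 3 * (2 * (1 / real n * m n) + 8 * ((F n / real n) * t n)
      + (1 / real n * (1 / real n * m n) + (F n)\<^sup>2 / (real n)\<^sup>2) * (2 + 2 / (real n - 1)))) \<longlonglongrightarrow> 0"
    by (simp only: mult_zero_right mult_zero_left add_0_right)
  have "\<forall>\<^sub>F n in sequentially. 3 * (2 * (1 / real n * m n) + 8 * ((F n / real n) * t n)
      + (1 / real n * (1 / real n * m n) + (F n)\<^sup>2 / (real n)\<^sup>2) * (2 + 2 / (real n - 1)))
      = 3 * ((2 * m n + 8 * (t n * F n)) / n + (m n + (F n)\<^sup>2) / (n choose 2))"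
    using eventually_ge_at_top[of 2]
  proof eventually_elim
    case (elim n)
    then have "real n > 0" "real n - 1 > 0" by auto
    moreover from this have "2 + 2 / (real n - 1) = 2 * real n / (real n - 1)"
      by (simp add: field_simps)
    ultimately show ?case
      unfolding real_choose_two by (simp add: divide_simps power2_eq_square)
  qed
  with lim show ?thesis
    by (rule Lim_transform_eventually)
qed

theorem corollary3p1:
  fixes M :: "nat \<Rightarrow> 'a measure" and p :: "nat \<Rightarrow> nat"
    and X :: "nat \<Rightarrow> 'a \<Rightarrow> nat \<Rightarrow> real" and Y :: "nat \<Rightarrow> 'a \<Rightarrow> real"
    and Xs :: "nat \<Rightarrow> nat \<Rightarrow> 'a \<Rightarrow> nat \<Rightarrow> real" and Ys :: "nat \<Rightarrow> nat \<Rightarrow> 'a \<Rightarrow> real"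
  assumes "\<And>n. model_free_sample (M n) n (p n) (X n) (Y n) (Xs n) (Ys n)"
    and "\<And>n. integrable (M n) (\<lambda>\<omega>. (Y n \<omega> - alpha (M n) (p n) (X n) (Y n)) ^ 4)"
    and "\<And>n j k. j < p n \<Longrightarrow> k < p n \<Longrightarrow>
      integrable (M n) (\<lambda>\<omega>. Wvec (X n \<omega>) (Y n \<omega>) j * Wvec (X n \<omega>) (Y n \<omega>) k)"
    and "bounded (range (\<lambda>n. mu4 (M n) (p n) (X n) (Y n)))"
    and "bounded (range (\<lambda>n. tau2 (M n) (p n) (X n) (Y n)))"
    and "(\<lambda>n. (frobenius_norm (p n) (A_mat (M n) (X n) (Y n)))\<^sup>2 / (real n)\<^sup>2) \<longlonglongrightarrow> 0"
  shows "tendsto_in_prob M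
    (\<lambda>n \<omega>. sigma2_hat n (p n) (\<lambda>i. Xs n i \<omega>) (\<lambda>i. Ys n i \<omega>) - sigma2 (M n) (p n) (X n) (Y n)) 0"
  unfolding tendsto_in_prob_def
proof (intro allI impI)
  fix e :: real assume e: "e > 0"
  let ?D = "\<lambda>n \<omega>. sigma2_hat n (p n) (\<lambda>i. Xs n i \<omega>) (\<lambda>i. Ys n i \<omega>) - sigma2 (M n) (p n) (X n) (Y n)"
  let ?B = "\<lambda>n. 3 * ((2 * mu4 (M n) (p n) (X n) (Y n) + 8 * (tau2 (M n) (p n) (X n) (Y n) *
      frobenius_norm (p n) (A_mat (M n) (X n) (Y n)))) / n
      + (mu4 (M n) (p n) (X n) (Y n) + (frobenius_norm (p n) (A_mat (M n) (X n) (Y n)))\<^sup>2) / (n choose 2))"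
  have "(\<lambda>n. ?B n / e\<^sup>2) \<longlonglongrightarrow> 0 / e\<^sup>2"
    using e by (intro tendsto_divide tendsto_const error_bound_tendsto_0 assms) auto
  then have lim: "(\<lambda>n. ?B n / e\<^sup>2) \<longlonglongrightarrow> 0" by simp
  have "measure (M n) {\<omega> \<in> space (M n). \<bar>?D n \<omega> - 0\<bar> > e} \<le> ?B n / e\<^sup>2" if n: "2 \<le> n" for n
  proof -
    interpret model_free_sample_fourth_moments "M n" n "p n" "X n" "Y n" "Xs n" "Ys n"
      using assms(1-3) by (simp add: model_free_sample_fourth_moments_def model_free_sample_fourth_moments_axioms_def)
    note mse = mean_squared_error[OF n]
    have "{\<omega> \<in> space (M n). e \<le> \<bar>?D n \<omega>\<bar>} \<in> sets (M n)"
      using mse(1) by measurable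
    then have "measure (M n) {\<omega> \<in> space (M n). \<bar>?D n \<omega> - 0\<bar> > e} \<le> measure (M n) {\<omega> \<in> space (M n). \<bar>?D n \<omega>\<bar> \<ge> e}"
      by (intro finite_measure_mono) auto
    also have "\<dots> \<le> expectation (\<lambda>\<omega>. (?D n \<omega>)\<^sup>2) / e\<^sup>2"
      by (rule second_moment_method[OF mse(1,2) e])
    also have "\<dots> \<le> ?B n / e\<^sup>2"
      using mse(3) by (intro divide_right_mono) auto
    finally show ?thesis .
  qed
  then have "\<forall>\<^sub>F n in sequentially. measure (M n) {\<omega> \<in> space (M n). \<bar>?D n \<omega> - 0\<bar> > e} \<le> ?B n / e\<^sup>2"
    using eventually_ge_at_top[of 2] by (rule eventually_mono[rotated])
  then show "(\<lambda>n. measure (M n) {\<omega> \<in> space (M n). \<bar>?D n \<omega> - 0\<bar> > e}) \<longlonglongrightarrow> 0"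
    by (intro real_tendsto_sandwich[OF _ _ tendsto_const lim]) auto
qed

end
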